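(* Let $s\ge 2$ be an integer and let $H$ be a connected graph. Then $$\operatorname{gp}(P_s\boxtimes H)=2\operatorname{gp}(H).$$
   Context: All graphs are finite, simple and connected. $d_G(u,v)$ is the usual shortest-path distance in $G$. A set $S\subseteq V(G)$ is a general position set of $G$ if no vertex of $S$ lies on a shortest path between two other vertices of $S$; equivalently, $d_G(u,v)\ne d_G(u,w)+d_G(w,v)$ for all pairwise distinct $u,v,w\in S$. The general position number $\operatorname{gp}(G)$ is the maximum cardinality of a general position set of $G$. The strong product $G\boxtimes H$ has vertex set $V(G)\times V(H)$; distinct vertices $(u_x,u_y)$ and $(v_x,v_y)$ are adjacent if and only if ($u_x=v_x$ and $u_yv_y\in E(H)$), or ($u_y=v_y$ and $u_xv_x\in E(G)$), or ($u_xv_x\in E(G)$ and $u_yv_y\in E(H)$). $P_s$ is the path on $s$ vertices. *)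

theory Defs
  imports "Graph_Theory.Graph_Theory"
begin

text \<open>
  Finite simple graphs are \<^locale>\<open>pair_graph\<close>s: finite, loopfree, symmetric digraphs whose arcs
  are pairs of vertices, an edge \<open>uv\<close> being the two arcs \<open>(u, v)\<close> and \<open>(v, u)\<close>.
\<close>

text \<open>
  The length of a shortest walk, as the library's weighted distance with every arc of cost 1.
  Its type is \<^typ>\<open>ereal\<close>, with value \<open>\<infinity>\<close> for vertices that are not joined by a walk.
\<close>
definition gdist :: "'a pair_pre_digraph \<Rightarrow> 'a \<Rightarrow> 'a \<Rightarrow> ereal" where
  "gdist G u v = wf_digraph.\<mu> (with_proj G) (\<lambda>_. 1) u v"

definition general_position_set :: "'a pair_pre_digraph \<Rightarrow> 'a set \<Rightarrow> bool" where
  "general_position_set G S \<longleftrightarrow> S \<subseteq> pverts G \<and>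
     (\<forall>u\<in>S. \<forall>v\<in>S. \<forall>w\<in>S. u \<noteq> v \<and> u \<noteq> w \<and> v \<noteq> w \<longrightarrow>
        gdist G u v \<noteq> gdist G u w + gdist G w v)"

definition gp :: "'a pair_pre_digraph \<Rightarrow> nat" where
  "gp G = Max {card S | S. general_position_set G S}"

definition strong_product ::
    "'a pair_pre_digraph \<Rightarrow> 'b pair_pre_digraph \<Rightarrow> ('a \<times> 'b) pair_pre_digraph"
    (infixl \<open>\<boxtimes>\<close> 70) where
  "G \<boxtimes> H = \<lparr>
     pverts = pverts G \<times> pverts H,
     parcs = {((ux, uy), (vx, vy)) | ux uy vx vy.
        (ux \<in> pverts G \<and> ux = vx \<and> (uy, vy) \<in> parcs H) \<or>
        (uy \<in> pverts H \<and> uy = vy \<and> (ux, vx) \<in> parcs G) \<or>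
        ((ux, vx) \<in> parcs G \<and> (uy, vy) \<in> parcs H)} \<rparr>"

definition path_graph :: "nat \<Rightarrow> nat pair_pre_digraph" where
  "path_graph s = \<lparr>
     pverts = {..<s},
     parcs = {(i, j). i < s \<and> j < s \<and> (j = Suc i \<or> i = Suc j)} \<rparr>"

lemma pair_graph_strong_product:
  assumes "pair_graph G" "pair_graph H"
  shows "pair_graph (G \<boxtimes> H)"
proof -
  interpret G: pair_graph G by fact
  interpret H: pair_graph H by fact
  let ?P = "G \<boxtimes> H"
  have sub: "parcs ?P \<subseteq> pverts ?P \<times> pverts ?P"
    by (auto simp: strong_product_def dest: G.wellformed' H.wellformed')
  have fin: "finite (pverts ?P)"
    by (simp add: strong_product_def G.pair_finite_verts H.pair_finite_verts)
  have symG: "(u, v) \<in> parcs G \<Longrightarrow> (v, u) \<in> parcs G" for u v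
    using G.pair_sym_arcs by (auto simp: symmetric_def sym_def)
  have symH: "(u, v) \<in> parcs H \<Longrightarrow> (v, u) \<in> parcs H" for u v
    using H.pair_sym_arcs by (auto simp: symmetric_def sym_def)
  show ?thesis
  proof unfold_locales
    show "finite (parcs ?P)"
      using sub fin by (meson finite_SigmaI finite_subset)
    show "symmetric (with_proj ?P)"
      using symG symH by (auto simp: symmetric_def sym_def strong_product_def)
  next
    fix e assume "e \<in> parcs ?P"
    then show "fst e \<noteq> snd e"
      using G.pair_no_loops H.pair_no_loops by (fastforce simp: strong_product_def)
  qed (use sub fin in auto)
qed

lemma pair_graph_path_graph: "pair_graph (path_graph s)"
proof unfold_locales
  show "finite (parcs (path_graph s))"
    by (rule finite_subset[of _ "{..<s} \<times> {..<s}"]) (auto simp: path_graph_def)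
qed (auto simp: path_graph_def symmetric_def sym_def)

end

theory Submission
  imports Defs
begin

text \<open>
  Distances in a strong product are maxima of distances in the factors: allowing a walk to stand
  still at a vertex, a walk of length \<open>n\<close> in the product is the same as a pair of walks of length
  \<open>n\<close>, one in each factor (\<open>lazy_step_relpow_strong_product\<close>). Hence
  \<open>d((i, x), (j, y)) = max \<bar>i - j\<bar> (d\<^sub>H(x, y))\<close> in the product of a path and \<open>H\<close>
  (\<open>gdist_path_strong_product\<close>).

  For the lower bound, two adjacent layers over a general position set of \<open>H\<close> are in general
  position (\<open>general_position_two_layers\<close>), because moving to the other layer changes no distance
  except that between the two copies of one vertex.

  For the upper bound, read the path coordinate as time. Say that \<open>(i, x)\<close> precedes \<open>(j, y)\<close> if a
  signal of speed 1 sent from \<open>x\<close> at time \<open>i\<close> reaches \<open>y\<close> by time \<open>j\<close>, that is, if \<open>i < j\<close> and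
  \<open>d\<^sub>H(x, y) \<le> j - i\<close>. Between points so related the distance is elapsed time, which is additive
  along chains, so a general position set has no chain of three points (\<open>no_causal_chain\<close>). It is
  therefore the union of two antichains: its minimal elements and the others. Between distinct points
  of an antichain the distance is that of their \<open>H\<close>-coordinates, so an antichain in general position
  projects injectively onto a general position set of \<open>H\<close> and has at most \<open>gp H\<close> elements
  (\<open>card_causal_antichain_le_gp\<close>).
\<close>

section \<open>Distances as iterates of a reflexive step relation\<close>

text \<open>
  Loops are added so that the \<open>n\<close>-th power of the relation describes the ball of radius \<open>n\<close> rather
  than the walks of length exactly \<open>n\<close>.
\<close>
definition lazy_step :: "'a pair_pre_digraph \<Rightarrow> 'a rel" where
  "lazy_step G = Id_on (pverts G) \<union> parcs G"

definition hops :: "'a pair_pre_digraph \<Rightarrow> 'a \<Rightarrow> 'a \<Rightarrow> nat" where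
  "hops G u v = (LEAST n. (u, v) \<in> lazy_step G ^^ n)"

lemma relpow_Suc_iff: "(u, v) \<in> R ^^ Suc n \<longleftrightarrow> (\<exists>w. (u, w) \<in> R \<and> (w, v) \<in> R ^^ n)"
  unfolding relpow.simps relpow_commute[symmetric] by blast

text \<open>
  A walk of length at most \<open>n\<close> becomes \<open>n\<close> lazy steps by waiting at its end; conversely,
  dropping the pauses of \<open>n\<close> lazy steps leaves a walk of the graph.
\<close>
lemma (in pair_wf_digraph) lazy_step_relpow_iff_awalk:
  assumes "u \<in> pverts G"
  shows "(u, v) \<in> lazy_step G ^^ n \<longleftrightarrow> (\<exists>p. awalk u p v \<and> length p \<le> n)"
  using assms
proof (induction n arbitrary: u)
  case 0
  then show ?case by (auto simp: awalk_Nil_iff)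
next
  case (Suc n)
  show ?case
  proof
    assume "(u, v) \<in> lazy_step G ^^ Suc n"
    then obtain w where w: "(u, w) \<in> lazy_step G" "(w, v) \<in> lazy_step G ^^ n"
      by (auto simp: relpow_Suc_iff simp del: relpow.simps)
    from w(1) have wV: "w \<in> pverts G"
      using in_arcsD2 by (auto simp: lazy_step_def)
    obtain p where p: "awalk w p v" "length p \<le> n"
      using w(2) Suc.IH[OF wV] by blast
    show "\<exists>p. awalk u p v \<and> length p \<le> Suc n"
    proof (cases "(u, w) \<in> parcs G")
      case True
      then have "awalk u ((u, w) # p) v"
        using p by (simp add: awalk_Cons_iff)
      then show ?thesis using p by (intro exI[of _ "(u, w) # p"]) auto
    next
      case False
      then have "w = u" using w(1) by (auto simp: lazy_step_def)
      then show ?thesis using p by auto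
    qed
  next
    assume "\<exists>p. awalk u p v \<and> length p \<le> Suc n"
    then obtain p where p: "awalk u p v" "length p \<le> Suc n" by blast
    show "(u, v) \<in> lazy_step G ^^ Suc n"
    proof (cases p)
      \<comment> \<open>The walk is already at its end \<open>v = u\<close>, so the first step is a pause there.\<close>
      case Nil
      then have "awalk u [] v \<and> length ([] :: ('a \<times> 'a) list) \<le> n" using p by simp
      then have "(u, v) \<in> lazy_step G ^^ n" using Suc.IH[OF Suc.prems] by blast
      moreover have "(u, u) \<in> lazy_step G" using Suc.prems by (auto simp: lazy_step_def)
      ultimately show ?thesis by (auto simp: relpow_Suc_iff simp del: relpow.simps)
    next
      case (Cons e q)
      obtain w where e: "e = (u, w)" "(u, w) \<in> parcs G" and q: "awalk w q v"
        using p Cons by (cases e) (auto simp: awalk_Cons_iff)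
      have "(w, v) \<in> lazy_step G ^^ n"
        using Suc.IH[of w] q p Cons e(2) in_arcsD2 by auto
      then show ?thesis using e by (auto simp: relpow_Suc_iff lazy_step_def simp del: relpow.simps)
    qed
  qed
qed

text \<open>
  A distance is determined by the radii of the balls around \<open>u\<close> that contain \<open>v\<close>; this is how all
  distances below are computed.
\<close>
lemma (in pair_wf_digraph) gdist_eqI:
  assumes "u \<in> pverts G" and balls: "\<And>n. (u, v) \<in> lazy_step G ^^ n \<longleftrightarrow> m \<le> n"
  shows "gdist G u v = ereal (real m)"
proof -
  have cost: "awalk_cost (\<lambda>_. 1) p = real (length p)" for p :: "('a \<times> 'a) list"
    by (induction p) auto
  note walk = lazy_step_relpow_iff_awalk[OF assms(1)]
  obtain p where p: "awalk u p v" "length p \<le> m"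
    using balls[of m] walk by auto
  have "gdist G u v \<le> ereal (real m)"
    using min_cost_le_walk_cost[OF p(1), of "\<lambda>_. 1"] p(2)
    by (auto simp: gdist_def cost intro: order_trans)
  moreover have "ereal (real m) \<le> gdist G u v"
    unfolding gdist_def \<mu>_def
    using balls walk by (intro INF_greatest) (auto simp: cost)
  ultimately show ?thesis by simp
qed

text \<open>
  Connectedness makes the set of radii in \<^const>\<open>hops\<close> nonempty, so that its least element is
  attained, and pauses make the set upward closed.
\<close>
lemma (in pair_graph) lazy_step_relpow_iff_hops:
  assumes "Digraph_Component.connected (with_proj G)" "u \<in> pverts G" "v \<in> pverts G"
  shows "(u, v) \<in> lazy_step G ^^ n \<longleftrightarrow> hops G u v \<le> n"
proof
  have "strongly_connected (with_proj G)"
    using assms(1) by (simp add: symmetric_connected_imp_strongly_connected sym_arcs)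
  then have "u \<rightarrow>\<^sup>*\<^bsub>with_proj G\<^esub> v"
    using assms(2,3) by auto
  then obtain p where "awalk u p v" by (auto simp: reachable_awalk)
  then have ex: "(u, v) \<in> lazy_step G ^^ length p"
    using lazy_step_relpow_iff_awalk[OF assms(2)] by auto
  then have "(u, v) \<in> lazy_step G ^^ hops G u v"
    unfolding hops_def by (rule LeastI)
  then show "(u, v) \<in> lazy_step G ^^ n" if "hops G u v \<le> n"
    using that lazy_step_relpow_iff_awalk[OF assms(2)] by (meson order_trans)
  show "hops G u v \<le> n" if "(u, v) \<in> lazy_step G ^^ n"
    using that unfolding hops_def by (rule Least_le)
qed

lemma (in pair_graph) gdist_eq_hops:
  assumes "Digraph_Component.connected (with_proj G)" "u \<in> pverts G" "v \<in> pverts G"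
  shows "gdist G u v = ereal (real (hops G u v))"
  using assms by (intro gdist_eqI lazy_step_relpow_iff_hops)

lemma (in pair_graph) hops_eq_0_iff:
  assumes "Digraph_Component.connected (with_proj G)" "u \<in> pverts G" "v \<in> pverts G"
  shows "hops G u v = 0 \<longleftrightarrow> u = v"
  using lazy_step_relpow_iff_hops[OF assms, of 0] by auto

lemma (in pair_graph) hops_triangle:
  assumes "Digraph_Component.connected (with_proj G)"
    and "u \<in> pverts G" "v \<in> pverts G" "w \<in> pverts G"
  shows "hops G u w \<le> hops G u v + hops G v w"
proof -
  have "(u, v) \<in> lazy_step G ^^ hops G u v" "(v, w) \<in> lazy_step G ^^ hops G v w"
    using assms by (simp_all add: lazy_step_relpow_iff_hops)
  then have "(u, w) \<in> lazy_step G ^^ (hops G u v + hops G v w)"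
    by (auto simp: relpow_add)
  then show ?thesis using assms by (simp add: lazy_step_relpow_iff_hops)
qed

lemma (in pair_graph) hops_commute:
  assumes "Digraph_Component.connected (with_proj G)" "u \<in> pverts G" "v \<in> pverts G"
  shows "hops G u v = hops G v u"
proof -
  have "sym (lazy_step G ^^ n)" for n
  proof (induction n)
    case (Suc n)
    have "sym (lazy_step G)"
      using arcs_symmetric by (auto simp: lazy_step_def sym_def)
    then have "(lazy_step G ^^ n O lazy_step G)\<inverse> = lazy_step G O lazy_step G ^^ n"
      using Suc by (simp add: converse_relcomp sym_conv_converse_eq)
    then show ?case by (simp add: sym_conv_converse_eq relpow_commute)
  qed (simp add: sym_Id)
  then have "hops G u v \<le> n \<longleftrightarrow> hops G v u \<le> n" for n
    using assms by (metis lazy_step_relpow_iff_hops symE)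
  then show ?thesis by (meson order_antisym order_refl)
qed

section \<open>Distances in a strong product\<close>

text \<open>
  The three kinds of edge of the strong product, together with its loops, are exactly the
  independent choices of an edge or a loop in each factor.
\<close>
lemma lazy_step_strong_product:
  assumes "pair_wf_digraph G" "pair_wf_digraph H"
  shows "((a, x), (b, y)) \<in> lazy_step (G \<boxtimes> H) \<longleftrightarrow> (a, b) \<in> lazy_step G \<and> (x, y) \<in> lazy_step H"
proof -
  interpret G: pair_wf_digraph G by fact
  interpret H: pair_wf_digraph H by fact
  show ?thesis
    by (auto simp: lazy_step_def strong_product_def dest: G.wellformed' H.wellformed')
qed

lemma lazy_step_relpow_strong_product:
  assumes "pair_wf_digraph G" "pair_wf_digraph H"
  shows "((a, x), (b, y)) \<in> lazy_step (G \<boxtimes> H) ^^ n \<longleftrightarrow>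
    (a, b) \<in> lazy_step G ^^ n \<and> (x, y) \<in> lazy_step H ^^ n"
proof (induction n arbitrary: a x)
  case (Suc n)
  then show ?case
    by (auto simp: relpow_Suc_iff lazy_step_strong_product[OF assms] simp del: relpow.simps)
qed auto

lemma lazy_step_relpow_path_graph:
  assumes "i < s" "j < s"
  shows "(i, j) \<in> lazy_step (path_graph s) ^^ n \<longleftrightarrow> nat \<bar>int i - int j\<bar> \<le> n"
  using assms
proof (induction n arbitrary: i)
  case (Suc n)
  have step: "(i, k) \<in> lazy_step (path_graph s) \<longleftrightarrow> k < s \<and> \<bar>int i - int k\<bar> \<le> 1" for k
    using Suc.prems by (auto simp: lazy_step_def path_graph_def Id_on_iff)
  have "(i, j) \<in> lazy_step (path_graph s) ^^ Suc n \<longleftrightarrow>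
      (\<exists>k<s. \<bar>int i - int k\<bar> \<le> 1 \<and> nat \<bar>int k - int j\<bar> \<le> n)"
    using Suc by (auto simp: relpow_Suc_iff step simp del: relpow.simps)
  also have "\<dots> \<longleftrightarrow> nat \<bar>int i - int j\<bar> \<le> Suc n"
  proof
    assume *: "nat \<bar>int i - int j\<bar> \<le> Suc n"
    \<comment> \<open>Move one vertex from \<open>i\<close> towards \<open>j\<close>.\<close>
    let ?k = "if i < j then Suc i else if j < i then i - 1 else i"
    have "?k < s \<and> \<bar>int i - int ?k\<bar> \<le> 1 \<and> nat \<bar>int ?k - int j\<bar> \<le> n"
      using * Suc.prems by auto
    then show "\<exists>k<s. \<bar>int i - int k\<bar> \<le> 1 \<and> nat \<bar>int k - int j\<bar> \<le> n" by blast
  qed auto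
  finally show ?case .
qed auto

lemma gdist_path_strong_product:
  assumes "pair_graph H" "Digraph_Component.connected (with_proj H)"
    and "i < s" "j < s" "x \<in> pverts H" "y \<in> pverts H"
  shows "gdist (path_graph s \<boxtimes> H) (i, x) (j, y)
    = ereal (real (max (nat \<bar>int i - int j\<bar>) (hops H x y)))"
proof -
  interpret H: pair_graph H by fact
  interpret P: pair_graph "path_graph s" by (rule pair_graph_path_graph)
  interpret PH: pair_graph "path_graph s \<boxtimes> H"
    by (intro pair_graph_strong_product) unfold_locales
  show ?thesis
  proof (rule PH.gdist_eqI)
    show "(i, x) \<in> pverts (path_graph s \<boxtimes> H)"
      using assms by (simp add: strong_product_def path_graph_def)
    show "((i, x), (j, y)) \<in> lazy_step (path_graph s \<boxtimes> H) ^^ n \<longleftrightarrow>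
        max (nat \<bar>int i - int j\<bar>) (hops H x y) \<le> n" for n
      using assms
      by (simp add: lazy_step_relpow_strong_product P.pair_wf_digraph H.pair_wf_digraph
          lazy_step_relpow_path_graph H.lazy_step_relpow_iff_hops)
  qed
qed

section \<open>The general position number as an attained maximum\<close>

lemma (in pair_fin_digraph) finite_general_position_cards:
  "finite {card S | S. general_position_set G S}"
  by (rule finite_subset[of _ "card ` Pow (pverts G)"])
    (auto simp: general_position_set_def pair_finite_verts)

lemma (in pair_fin_digraph) card_le_gp:
  "general_position_set G S \<Longrightarrow> card S \<le> gp G"
  unfolding gp_def by (rule Max_ge[OF finite_general_position_cards]) auto

lemma (in pair_fin_digraph) gp_attained:
  obtains S where "general_position_set G S" "card S = gp G"
proof -
  have "general_position_set G {}" by (simp add: general_position_set_def)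
  then have "gp G \<in> {card S | S. general_position_set G S}"
    unfolding gp_def by (intro Max_in finite_general_position_cards) auto
  then show thesis using that by auto
qed

section \<open>Lower bound: two adjacent layers\<close>

text \<open>
  A triple with three different \<open>H\<close>-coordinates has the distances of its projection. If two of its
  points lie over the same vertex, the three distances are 1, \<open>d\<close> and \<open>d\<close> for some \<open>d \<ge> 1\<close>,
  and none of them is the sum of the other two unless \<open>d + d = 1\<close>, which is impossible.
\<close>
lemma general_position_two_layers:
  fixes H :: "'b pair_pre_digraph"
  assumes "pair_graph H" "Digraph_Component.connected (with_proj H)"
    and "s \<ge> 2" and S: "general_position_set H S"
  shows "general_position_set (path_graph s \<boxtimes> H) ({0, 1} \<times> S)"
  unfolding general_position_set_def
proof (intro conjI ballI impI)
  interpret H: pair_graph H by fact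
  have SV: "S \<subseteq> pverts H" using S by (simp add: general_position_set_def)
  show "{0, 1} \<times> S \<subseteq> pverts (path_graph s \<boxtimes> H)"
    using SV \<open>s \<ge> 2\<close> by (auto simp: strong_product_def path_graph_def)
  fix p q r :: "nat \<times> 'b"
  assume mem: "p \<in> {0, 1} \<times> S" "q \<in> {0, 1} \<times> S" "r \<in> {0, 1} \<times> S"
    and ne: "p \<noteq> q \<and> p \<noteq> r \<and> q \<noteq> r"
  obtain i x j y k z where pqr: "p = (i, x)" "q = (j, y)" "r = (k, z)"
    by (metis surj_pair)
  have V: "x \<in> pverts H" "y \<in> pverts H" "z \<in> pverts H"
    and layer: "i \<in> {0, 1}" "j \<in> {0, 1}" "k \<in> {0, 1}"
    using mem SV by (auto simp: pqr)
  have pos: "hops H x y = 0 \<longleftrightarrow> x = y" "hops H x z = 0 \<longleftrightarrow> x = z" "hops H z y = 0 \<longleftrightarrow> z = y"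
    using V by (simp_all add: H.hops_eq_0_iff assms(2))
  have gen: "hops H x y \<noteq> hops H x z + hops H z y" if "x \<noteq> y" "x \<noteq> z" "y \<noteq> z"
  proof -
    have "gdist H x y \<noteq> gdist H x z + gdist H z y"
      using S that mem by (simp add: general_position_set_def pqr)
    then show ?thesis using V by (simp add: H.gdist_eq_hops assms(2))
  qed
  have "max (nat \<bar>int i - int j\<bar>) (hops H x y)
      \<noteq> max (nat \<bar>int i - int k\<bar>) (hops H x z) + max (nat \<bar>int k - int j\<bar>) (hops H z y)"
    using gen pos layer ne unfolding pqr
    by (cases "x = y"; cases "x = z"; cases "z = y") auto
  then show "gdist (path_graph s \<boxtimes> H) p q
      \<noteq> gdist (path_graph s \<boxtimes> H) p r + gdist (path_graph s \<boxtimes> H) r q"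
    using V layer \<open>s \<ge> 2\<close>
    by (auto simp add: pqr gdist_path_strong_product assms(1,2) simp del: of_nat_max)
qed

section \<open>Upper bound: causal chains and antichains\<close>

text \<open>
  The causal order of a discrete spacetime with time axis \<open>\<nat>\<close> and space \<open>H\<close>.
\<close>
definition causally_precedes :: "'b pair_pre_digraph \<Rightarrow> nat \<times> 'b \<Rightarrow> nat \<times> 'b \<Rightarrow> bool" where
  "causally_precedes H p q \<longleftrightarrow> fst p < fst q \<and> hops H (snd p) (snd q) \<le> fst q - fst p"

text \<open>
  By the triangle inequality in \<open>H\<close> the ends \<open>p\<close> and \<open>r\<close> are causally related too. So all three
  distances are differences of times, and \<open>q\<close> lies on a shortest path from \<open>p\<close> to \<open>r\<close>.
\<close>
lemma no_causal_chain:
  assumes "pair_graph H" "Digraph_Component.connected (with_proj H)"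
    and S: "general_position_set (path_graph s \<boxtimes> H) S" and "p \<in> S" "q \<in> S" "r \<in> S"
    and "causally_precedes H p q" "causally_precedes H q r"
  shows False
proof -
  interpret H: pair_graph H by fact
  obtain i x j y k z where pqr: "p = (i, x)" "q = (j, y)" "r = (k, z)"
    by (metis surj_pair)
  have V: "x \<in> pverts H" "y \<in> pverts H" "z \<in> pverts H" "i < s" "j < s" "k < s"
    using S \<open>p \<in> S\<close> \<open>q \<in> S\<close> \<open>r \<in> S\<close>
    by (auto simp: general_position_set_def pqr strong_product_def path_graph_def)
  have order: "i < j" "j < k" "hops H x y \<le> j - i" "hops H y z \<le> k - j"
    using assms(7,8) by (auto simp: causally_precedes_def pqr)
  have "hops H x z \<le> k - i"
    using H.hops_triangle[OF assms(2), of x y z] V order by linarith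
  then have "gdist (path_graph s \<boxtimes> H) p r
      = gdist (path_graph s \<boxtimes> H) p q + gdist (path_graph s \<boxtimes> H) q r"
    using V order
    by (auto simp add: pqr gdist_path_strong_product assms(1,2) max_absorb1 simp del: of_nat_max)
  moreover have "p \<noteq> r" "p \<noteq> q" "r \<noteq> q" using order by (auto simp: pqr)
  ultimately show False
    using S \<open>p \<in> S\<close> \<open>q \<in> S\<close> \<open>r \<in> S\<close> unfolding general_position_set_def by blast
qed

text \<open>
  Distinct unrelated points are further apart in space than in time. Thus their distance is the
  spatial one, which moreover is positive, and the projection to \<open>H\<close> preserves both cardinality
  and general position.
\<close>
lemma card_causal_antichain_le_gp:
  assumes "pair_graph H" "Digraph_Component.connected (with_proj H)"
    and A: "general_position_set (path_graph s \<boxtimes> H) A"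
    and antichain: "\<And>p q. p \<in> A \<Longrightarrow> q \<in> A \<Longrightarrow> \<not> causally_precedes H p q"
  shows "card A \<le> gp H"
proof -
  interpret H: pair_graph H by fact
  have V: "fst p < s" "snd p \<in> pverts H" if "p \<in> A" for p
    using A that by (auto simp: general_position_set_def strong_product_def path_graph_def)
  have faster: "nat \<bar>int (fst p) - int (fst q)\<bar> < hops H (snd p) (snd q)"
    if "p \<in> A" "q \<in> A" "p \<noteq> q" for p q
  proof (cases "fst p" "fst q" rule: linorder_cases)
    case equal
    then have "snd p \<noteq> snd q" using \<open>p \<noteq> q\<close> by (auto simp: prod_eq_iff)
    then have "hops H (snd p) (snd q) \<noteq> 0"
      using that V by (simp add: H.hops_eq_0_iff assms(2))
    then show ?thesis using equal by simp
  next
    case less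
    then show ?thesis using antichain[of p q] that by (auto simp: causally_precedes_def)
  next
    case greater
    then show ?thesis
      using antichain[of q p] that V H.hops_commute[OF assms(2), of "snd p" "snd q"]
      by (auto simp: causally_precedes_def)
  qed
  have inj: "inj_on snd A"
  proof (rule inj_onI, rule ccontr)
    fix p q assume "p \<in> A" "q \<in> A" "snd p = snd q" "p \<noteq> q"
    then show False
      using faster[of p q] V H.hops_eq_0_iff[OF assms(2), of "snd p" "snd p"] by simp
  qed
  have isometric: "gdist (path_graph s \<boxtimes> H) p q = gdist H (snd p) (snd q)"
    if "p \<in> A" "q \<in> A" "p \<noteq> q" for p q
    using faster[OF that] V that
      gdist_path_strong_product[OF assms(1,2), of "fst p" s "fst q" "snd p" "snd q"]
    by (simp add: H.gdist_eq_hops assms(2) max_absorb2)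
  have "general_position_set H (snd ` A)"
    unfolding general_position_set_def
  proof (intro conjI ballI impI)
    show "snd ` A \<subseteq> pverts H" using V by auto
    fix x y z
    assume "x \<in> snd ` A" "y \<in> snd ` A" "z \<in> snd ` A" and ne: "x \<noteq> y \<and> x \<noteq> z \<and> y \<noteq> z"
    then obtain p q r where pqr: "p \<in> A" "q \<in> A" "r \<in> A" "x = snd p" "y = snd q" "z = snd r"
      by blast
    then have "p \<noteq> q" "p \<noteq> r" "q \<noteq> r" using ne by auto
    then show "gdist H x y \<noteq> gdist H x z + gdist H z y"
      using A pqr(1-3) unfolding general_position_set_def pqr(4-6)
      by (metis isometric)
  qed
  then show ?thesis
    using H.card_le_gp card_image[OF inj] by metis
qed

lemma general_position_set_subset:
  "general_position_set G S \<Longrightarrow> T \<subseteq> S \<Longrightarrow> general_position_set G T"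
  unfolding general_position_set_def by blast

text \<open>
  Mirsky's decomposition of an order of height at most 2: the set \<open>A\<close> of minimal elements is an
  antichain, and two related elements outside \<open>A\<close> would extend downwards to a chain of three.
\<close>
lemma card_general_position_path_strong_product_le:
  assumes "pair_graph H" "Digraph_Component.connected (with_proj H)"
    and S: "general_position_set (path_graph s \<boxtimes> H) S"
  shows "card S \<le> 2 * gp H"
proof -
  define A where "A = {p \<in> S. \<forall>q\<in>S. \<not> causally_precedes H q p}"
  have "card A \<le> gp H"
    using general_position_set_subset[OF S, of A]
    by (intro card_causal_antichain_le_gp[OF assms(1,2)]) (auto simp: A_def)
  moreover have "card (S - A) \<le> gp H"
  proof (rule card_causal_antichain_le_gp[OF assms(1,2)])
    show "general_position_set (path_graph s \<boxtimes> H) (S - A)"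
      using S by (rule general_position_set_subset) blast
    show "\<not> causally_precedes H p q" if "p \<in> S - A" "q \<in> S - A" for p q
    proof
      assume "causally_precedes H p q"
      moreover obtain r where "r \<in> S" "causally_precedes H r p"
        using \<open>p \<in> S - A\<close> by (auto simp: A_def)
      ultimately show False
        using no_causal_chain[OF assms(1,2) S] that by blast
    qed
  qed
  moreover have "card S \<le> card A + card (S - A)"
    using card_Un_le[of A "S - A"] by (simp add: A_def Un_absorb1)
  ultimately show ?thesis by linarith
qed

theorem theorem2p2:
  fixes s :: nat and H :: "'b pair_pre_digraph"
  assumes "s \<ge> 2"
    and "pair_graph H"
    and "Digraph_Component.connected (with_proj H)"
  shows "gp (path_graph s \<boxtimes> H) = 2 * gp H"
proof (rule order_antisym)
  interpret H: pair_graph H by fact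
  interpret PH: pair_graph "path_graph s \<boxtimes> H"
    using assms(2) by (intro pair_graph_strong_product pair_graph_path_graph)
  show "gp (path_graph s \<boxtimes> H) \<le> 2 * gp H"
    using PH.gp_attained card_general_position_path_strong_product_le[OF assms(2,3)] by metis
  obtain S where "general_position_set H S" "card S = gp H"
    by (rule H.gp_attained)
  then have "card ({0, 1 :: nat} \<times> S) \<le> gp (path_graph s \<boxtimes> H)"
    using general_position_two_layers assms by (intro PH.card_le_gp) blast
  then show "2 * gp H \<le> gp (path_graph s \<boxtimes> H)"
    using \<open>card S = gp H\<close> by (simp add: card_cartesian_product)
qed

end
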